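(* Let $G$ be a computable graph that is not isomorphic to $K_\omega$, $\overline{K}_\omega$, or the random graph $\mathcal{R}$. Then there is a computable graph $H$ isomorphic to $G$ and a computable partition of the vertex set $H=X_0\sqcup X_1$ such that neither the induced subgraph on $X_0$ nor the induced subgraph on $X_1$ is (classically) isomorphic to $G$.
   Context: A graph is a set of vertices $V\subseteq\mathbb{N}$ with an irreflexive symmetric edge relation; it is computable if $V$ and the edge relation are computable. $K_\omega$ is the complete graph on $\mathbb{N}$, $\overline{K}_\omega$ the edgeless graph on $\mathbb{N}$, and $\mathcal{R}$ the countable random graph, i.e. the unique-up-to-isomorphism countable graph such that for all disjoint finite vertex sets $A,B$ there is a vertex $x\notin A\cup B$ adjacent to every vertex of $A$ and to no vertex of $B$.
   Formalization: The graph G is additionally assumed to have at least two vertices, because the claim is false for the empty graph and the one-vertex graph, where some part of any partition is isomorphic to G. *)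

theory Defs
  imports Main
begin

text \<open>Computability on \<open>\<nat>\<close> is given by Kleene's partial recursive functions: programs together
  with a big-step evaluation relation; \<open>eval p xs y\<close> means that \<open>p\<close> halts on the arguments \<open>xs\<close>
  with value \<open>y\<close>. Arities are not tracked by the syntax: a program may halt on argument lists of
  several lengths, and only its behaviour on the lengths named in the definitions below matters.\<close>

datatype recfun =
    Zero
  | Succ
  | Proj nat
  | Comp recfun "recfun list"
  | PrimRec recfun recfun
  | Mu recfun

inductive eval :: "recfun \<Rightarrow> nat list \<Rightarrow> nat \<Rightarrow> bool" where
  zero: "eval Zero xs 0"
| succ: "eval Succ [x] (Suc x)"
| proj: "i < length xs \<Longrightarrow> eval (Proj i) xs (xs ! i)"
| comp: "list_all2 (\<lambda>g y. eval g xs y) gs ys \<Longrightarrow> eval f ys z \<Longrightarrow> eval (Comp f gs) xs z"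
| primrec_0: "eval f xs y \<Longrightarrow> eval (PrimRec f g) (0 # xs) y"
| primrec_Suc: "eval (PrimRec f g) (n # xs) r \<Longrightarrow> eval g (n # r # xs) y
    \<Longrightarrow> eval (PrimRec f g) (Suc n # xs) y"
| mu: "eval f (n # xs) 0 \<Longrightarrow> (\<forall>m<n. \<exists>y>0. eval f (m # xs) y) \<Longrightarrow> eval (Mu f) xs n"

text \<open>Since programs are deterministic, demanding the correct value of the characteristic function
  on every input says that the program decides the set.\<close>

inductive_cases eval_ZeroE: "eval Zero xs y"
inductive_cases eval_SuccE: "eval Succ xs y"
inductive_cases eval_ProjE: "eval (Proj i) xs y"
inductive_cases eval_CompE: "eval (Comp f gs) xs y"
inductive_cases eval_PrimRec_0E: "eval (PrimRec f g) (0 # xs) y"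
inductive_cases eval_PrimRec_SucE: "eval (PrimRec f g) (Suc n # xs) y"
inductive_cases eval_MuE: "eval (Mu f) xs y"

lemma eval_deterministic: "eval p xs y \<Longrightarrow> eval p xs z \<Longrightarrow> y = z"
proof (induction arbitrary: z rule: eval.induct)
  case (zero xs)
  then show ?case by (rule eval_ZeroE) simp
next
  case (succ x)
  then show ?case by (rule eval_SuccE) simp
next
  case (proj i xs)
  from proj.prems show ?case by (rule eval_ProjE) simp
next
  case (comp xs gs ys f v)
  from comp.prems obtain ys' where
    ys': "list_all2 (\<lambda>g y. eval g xs y) gs ys'" "eval f ys' z"
    by (rule eval_CompE) 
  have "ys = ys'"
    using comp.IH(1) ys'(1) by (auto simp: list_all2_conv_all_nth intro!: nth_equalityI)
  with comp.IH(2) ys'(2) show ?case by simp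
next
  case (primrec_0 f xs y g)
  from primrec_0.prems have "eval f xs z" by (rule eval_PrimRec_0E)
  then show ?case by (rule primrec_0.IH)
next
  case (primrec_Suc f g n xs r y)
  from primrec_Suc.prems obtain r' where
    r': "eval (PrimRec f g) (n # xs) r'" "eval g (n # r' # xs) z"
    by (rule eval_PrimRec_SucE)
  have "r = r'" using r'(1) by (rule primrec_Suc.IH(1))
  with r'(2) show ?case using primrec_Suc.IH(2) by simp
next
  case (mu f n xs)
  from mu.prems have z: "eval f (z # xs) 0" "\<forall>m<z. \<exists>y>0. eval f (m # xs) y"
    by (rule eval_MuE, simp)+
  show ?case
  proof (rule linorder_cases[of n z])
    assume "n < z"
    then obtain y where "y > 0" "eval f (n # xs) y" using z(2) by blast
    with mu.IH(1)[of y] show ?thesis by simp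
  next
    assume "z < n"
    then obtain y where "y > 0" "\<forall>x. eval f (z # xs) x \<longrightarrow> y = x" using mu.IH(2) by blast
    with z(1) have "y = 0" by blast
    with \<open>y > 0\<close> show ?thesis by simp
  qed
qed

definition computable_set :: "nat set \<Rightarrow> bool" where
  "computable_set A \<longleftrightarrow> (\<exists>p. \<forall>x. eval p [x] (if x \<in> A then 1 else 0))"

definition computable_rel :: "(nat \<times> nat) set \<Rightarrow> bool" where
  "computable_rel R \<longleftrightarrow> (\<exists>p. \<forall>x y. eval p [x, y] (if (x, y) \<in> R then 1 else 0))"

record graph =
  verts :: "nat set"
  edges :: "(nat \<times> nat) set"

definition is_graph :: "graph \<Rightarrow> bool" where
  "is_graph G \<longleftrightarrow> edges G \<subseteq> verts G \<times> verts G \<and> irrefl (edges G) \<and> sym (edges G)"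

definition computable_graph :: "graph \<Rightarrow> bool" where
  "computable_graph G \<longleftrightarrow> is_graph G \<and> computable_set (verts G) \<and> computable_rel (edges G)"

definition graph_iso :: "graph \<Rightarrow> graph \<Rightarrow> bool" where
  "graph_iso G H \<longleftrightarrow> (\<exists>f. bij_betw f (verts G) (verts H) \<and>
     (\<forall>x\<in>verts G. \<forall>y\<in>verts G. (x, y) \<in> edges G \<longleftrightarrow> (f x, f y) \<in> edges H))"

definition induced_subgraph :: "graph \<Rightarrow> nat set \<Rightarrow> graph" where
  "induced_subgraph G X = \<lparr>verts = verts G \<inter> X, edges = edges G \<inter> X \<times> X\<rparr>"

definition K_omega :: graph where
  "K_omega = \<lparr>verts = UNIV, edges = {(x, y). x \<noteq> y}\<rparr>"

definition edgeless_omega :: graph where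
  "edgeless_omega = \<lparr>verts = UNIV, edges = {}\<rparr>"

text \<open>The random graph is determined only up to isomorphism, so it is given as a predicate
  rather than as a constant. Countability is automatic, as vertices are natural numbers.\<close>

definition is_random_graph :: "graph \<Rightarrow> bool" where
  "is_random_graph R \<longleftrightarrow> is_graph R \<and>
     (\<forall>A B. finite A \<and> finite B \<and> A \<subseteq> verts R \<and> B \<subseteq> verts R \<and> A \<inter> B = {} \<longrightarrow>
       (\<exists>x\<in>verts R - (A \<union> B). (\<forall>a\<in>A. (x, a) \<in> edges R) \<and> (\<forall>b\<in>B. (x, b) \<notin> edges R)))"

end

theory Submission
  imports Defs "HOL-Library.Countable_Set"
begin

text \<open>If \<open>G\<close> has both an edge and an isolated vertex, separating the isolated vertices from the others
  leaves one side without edges and the other without isolated vertices; dually, one passes to the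
  complement if \<open>G\<close> has a dominating vertex. Otherwise the extension property of the random graph holds
  for configurations with at most one vertex but fails for some larger one. A minimal failure cuts
  \<open>G\<close>, by a condition computable from finitely many parameters, into two parts in which smaller
  configurations fail already.\<close>

section \<open>Computable functions and decidable predicates\<close>

text \<open>Taking the whole argument list as input lets syntax-directed closure rules handle
  functions of any arity. Lists of other lengths are left open, as programs do not track
  arity.\<close>

definition computable_fun :: "nat \<Rightarrow> (nat list \<Rightarrow> nat) \<Rightarrow> bool" where
  "computable_fun n f \<longleftrightarrow> (\<exists>p. \<forall>xs. length xs = n \<longrightarrow> eval p xs (f xs))"

definition decidable :: "nat \<Rightarrow> (nat list \<Rightarrow> bool) \<Rightarrow> bool" where
  "decidable n P \<longleftrightarrow> computable_fun n (\<lambda>xs. if P xs then 1 else 0)"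

named_theorems comp_intros

lemma computable_fun_cong:
  assumes "computable_fun n f" "\<And>xs. length xs = n \<Longrightarrow> f xs = g xs"
  shows "computable_fun n g"
  using assms by (auto simp: computable_fun_def)

section \<open>Closure under composition and primitive recursion\<close>

lemma computable_fun_Comp:
  assumes f: "computable_fun (length gs) f" and gs: "\<forall>g\<in>set gs. computable_fun n g"
  shows "computable_fun n (\<lambda>xs. f (map (\<lambda>g. g xs) gs))"
proof -
  obtain p where p: "\<And>xs. length xs = length gs \<Longrightarrow> eval p xs (f xs)"
    using f by (auto simp: computable_fun_def)
  have "\<exists>q. \<forall>g\<in>set gs. \<forall>xs. length xs = n \<longrightarrow> eval (q g) xs (g xs)"
    using gs unfolding computable_fun_def by (intro bchoice)
  then obtain q where q: "\<And>g xs. g \<in> set gs \<Longrightarrow> length xs = n \<Longrightarrow> eval (q g) xs (g xs)"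
    by blast
  have "eval (Comp p (map q gs)) xs (f (map (\<lambda>g. g xs) gs))" if "length xs = n" for xs
    by (rule eval.comp[where ys = "map (\<lambda>g. g xs) gs"])
      (use p q that in \<open>auto simp: list_all2_conv_all_nth\<close>)
  then show ?thesis by (auto simp: computable_fun_def)
qed

lemma computable_fun_comp1:
  assumes "computable_fun 1 (\<lambda>xs. F (xs ! 0))" "computable_fun n g"
  shows "computable_fun n (\<lambda>xs. F (g xs))"
  using computable_fun_Comp[of "[g]" "\<lambda>xs. F (xs ! 0)" n] assms by simp

lemma computable_fun_comp2:
  assumes "computable_fun 2 (\<lambda>xs. F (xs ! 0) (xs ! 1))" "computable_fun n g" "computable_fun n h"
  shows "computable_fun n (\<lambda>xs. F (g xs) (h xs))"
  using computable_fun_Comp[of "[g, h]" "\<lambda>xs. F (xs ! 0) (xs ! 1)" n] assms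
  by (simp add: numeral_2_eq_2)

lemma computable_fun_nth [comp_intros]:
  "i < n \<Longrightarrow> computable_fun n (\<lambda>xs. xs ! i)"
  by (auto simp: computable_fun_def intro!: exI[of _ "Proj i"] eval.proj)

text \<open>Each bounded quantifier adds its variable at the head of the argument list, so the
  variables under nested quantifiers appear as the following combinations of heads and tails.\<close>

lemma computable_fun_hd [comp_intros]: "0 < n \<Longrightarrow> computable_fun n hd"
  by (rule computable_fun_cong[OF computable_fun_nth[of 0]]) (auto simp: hd_conv_nth)

lemma computable_fun_nth_tl [comp_intros]:
  "Suc i < n \<Longrightarrow> computable_fun n (\<lambda>xs. tl xs ! i)"
  by (rule computable_fun_cong[OF computable_fun_nth[of "Suc i"]]) (auto simp: nth_tl)

lemma computable_fun_hd_tl [comp_intros]: "1 < n \<Longrightarrow> computable_fun n (\<lambda>xs. hd (tl xs))"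
  by (rule computable_fun_cong[OF computable_fun_nth[of 1]])
    (auto simp: hd_conv_nth nth_tl simp flip: length_0_conv)

lemma computable_fun_nth_tl_tl [comp_intros]:
  "Suc (Suc i) < n \<Longrightarrow> computable_fun n (\<lambda>xs. tl (tl xs) ! i)"
  by (rule computable_fun_cong[OF computable_fun_nth[of "Suc (Suc i)"]]) (auto simp: nth_tl)

lemma computable_fun_Suc [comp_intros]:
  assumes "computable_fun n f"
  shows "computable_fun n (\<lambda>xs. Suc (f xs))"
proof (rule computable_fun_comp1[of Suc, OF _ assms])
  show "computable_fun 1 (\<lambda>xs. Suc (xs ! 0))"
    unfolding computable_fun_def
    by (rule exI[of _ Succ]) (auto simp: length_Suc_conv intro: eval.succ)
qed

lemma computable_fun_const [comp_intros]: "computable_fun n (\<lambda>_. c)"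
proof (induction c)
  case 0
  show ?case unfolding computable_fun_def by (auto intro: eval.zero)
qed (rule computable_fun_Suc)

lemma computable_fun_PrimRec:
  assumes "computable_fun n f" "computable_fun (Suc (Suc n)) g"
  shows "computable_fun (Suc n) (\<lambda>xs. rec_nat (f (tl xs)) (\<lambda>k r. g (k # r # tl xs)) (hd xs))"
proof -
  obtain p where p: "\<And>xs. length xs = n \<Longrightarrow> eval p xs (f xs)"
    using assms(1) by (auto simp: computable_fun_def)
  obtain q where q: "\<And>xs. length xs = Suc (Suc n) \<Longrightarrow> eval q xs (g xs)"
    using assms(2) by (auto simp: computable_fun_def)
  have "eval (PrimRec p q) (m # xs) (rec_nat (f xs) (\<lambda>k r. g (k # r # xs)) m)"
    if "length xs = n" for m xs
    by (induction m) (use p q that in \<open>auto intro: eval.primrec_0 eval.primrec_Suc\<close>)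
  then show ?thesis
    unfolding computable_fun_def by (intro exI[of _ "PrimRec p q"]) (auto simp: length_Suc_conv)
qed

text \<open>Recursion equations with one parameter \<open>y\<close> are matched directly, and the
  result is composed with \<open>a\<close> and \<open>b\<close> at once. Unary recursions are
  covered by letting \<open>F\<close> ignore \<open>y\<close>.\<close>

lemma computable_fun_recursion:
  assumes F: "\<And>y. F 0 y = f y" "\<And>x y. F (Suc x) y = g x (F x y) y"
    and f: "computable_fun 1 (\<lambda>xs. f (xs ! 0))"
    and g: "computable_fun 3 (\<lambda>xs. g (xs ! 0) (xs ! 1) (xs ! 2))"
    and ab: "computable_fun n a" "computable_fun n b"
  shows "computable_fun n (\<lambda>xs. F (a xs) (b xs))"
proof (rule computable_fun_comp2[OF _ ab])
  have rec: "rec_nat (f y) (\<lambda>k r. g k r y) x = F x y" for x y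
    by (induction x) (simp_all add: F)
  have "computable_fun (Suc 1) (\<lambda>xs. rec_nat (f (tl xs ! 0))
      (\<lambda>k r. (\<lambda>xs. g (xs ! 0) (xs ! 1) (xs ! 2)) (k # r # tl xs)) (hd xs))"
    by (rule computable_fun_PrimRec) (use f g in \<open>simp_all add: numeral_3_eq_3\<close>)
  then show "computable_fun 2 (\<lambda>xs. F (xs ! 0) (xs ! 1))"
    unfolding Suc_1 by (rule computable_fun_cong) (auto simp: length_Suc_conv numeral_2_eq_2 rec)
qed

lemma computable_fun_add [comp_intros]:
  assumes "computable_fun n f" "computable_fun n g"
  shows "computable_fun n (\<lambda>xs. f xs + g xs)"
  by (rule computable_fun_recursion[where F = "(+)" and f = "\<lambda>y. y" and g = "\<lambda>x r y. Suc r"])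
    (use assms in \<open>auto intro!: comp_intros\<close>)

lemma computable_fun_pred:
  assumes "computable_fun n f"
  shows "computable_fun n (\<lambda>xs. f xs - 1)"
  by (rule computable_fun_recursion[where F = "\<lambda>x y. x - 1" and f = "\<lambda>y. 0" and g = "\<lambda>x r y. x"])
    (use assms in \<open>auto intro!: comp_intros\<close>)

lemma computable_fun_diff [comp_intros]:
  assumes "computable_fun n f" "computable_fun n g"
  shows "computable_fun n (\<lambda>xs. f xs - g xs)"
  \<comment> \<open>Recursion runs on the first argument of \<open>F\<close>, so the subtrahend
    comes first: subtracting is iterating the predecessor.\<close>
  by (rule computable_fun_recursion[where F = "\<lambda>x y. y - x" and f = "\<lambda>y. y" and g = "\<lambda>x r y. r - 1"])
    (use assms in \<open>auto intro!: comp_intros computable_fun_pred simp del: One_nat_def\<close>)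

text \<open>Triangular numbers satisfy a simple recursion, which avoids division; they are the only
  nontrivial ingredient of \<open>prod_encode\<close>.\<close>

lemma computable_fun_triangle:
  assumes "computable_fun n f"
  shows "computable_fun n (\<lambda>xs. triangle (f xs))"
  by (rule computable_fun_recursion[where F = "\<lambda>x y. triangle x" and f = "\<lambda>y. 0"
        and g = "\<lambda>x r y. r + Suc x"])
    (use assms in \<open>auto intro!: comp_intros\<close>)

lemma computable_fun_prod_encode [comp_intros]:
  assumes "computable_fun n f" "computable_fun n g"
  shows "computable_fun n (\<lambda>xs. prod_encode (f xs, g xs))"
  unfolding prod_encode_def using assms
  by (auto intro!: comp_intros computable_fun_triangle)

section \<open>Decidable predicates and bounded quantifiers\<close>

lemma decidable_cong:
  assumes "decidable n P" "\<And>xs. length xs = n \<Longrightarrow> P xs = Q xs"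
  shows "decidable n Q"
  using assms(1) unfolding decidable_def
  by (rule computable_fun_cong) (simp add: assms(2))

text \<open>Truncated subtraction makes \<open>1 - f xs\<close> a characteristic function. Negation,
  conjunction and comparison are all reduced to this test.\<close>

lemma decidable_zero:
  assumes "computable_fun n f"
  shows "decidable n (\<lambda>xs. f xs = 0)"
  unfolding decidable_def
  by (rule computable_fun_cong[of _ "\<lambda>xs. 1 - f xs"]) (use assms in \<open>auto intro: comp_intros\<close>)

lemma decidable_not [comp_intros]:
  assumes "decidable n P"
  shows "decidable n (\<lambda>xs. \<not> P xs)"
  by (rule decidable_cong[OF decidable_zero[OF assms[unfolded decidable_def]]]) auto

lemma decidable_conj [comp_intros]:
  assumes "decidable n P" "decidable n Q"
  shows "decidable n (\<lambda>xs. P xs \<and> Q xs)"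
proof -
  have "decidable n (\<lambda>xs. (if \<not> P xs then 1 else 0) + (if \<not> Q xs then 1 else 0) = (0::nat))"
    using assms[THEN decidable_not] unfolding decidable_def[of n "\<lambda>xs. \<not> _ xs"]
    by (intro decidable_zero computable_fun_add)
  then show ?thesis by (rule decidable_cong) auto
qed

lemma decidable_disj [comp_intros]:
  assumes "decidable n P" "decidable n Q"
  shows "decidable n (\<lambda>xs. P xs \<or> Q xs)"
  using decidable_not[OF decidable_conj[OF assms[THEN decidable_not]]] by simp

lemma decidable_const [comp_intros]: "decidable n (\<lambda>_. c)"
  unfolding decidable_def by (rule computable_fun_const)

lemma decidable_less [comp_intros]:
  assumes "computable_fun n f" "computable_fun n g"
  shows "decidable n (\<lambda>xs. f xs < g xs)"
  by (rule decidable_cong[of _ "\<lambda>xs. Suc (f xs) - g xs = 0"])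
    (use assms in \<open>auto intro!: decidable_zero comp_intros simp del: diff_is_0_eq\<close>)

lemma decidable_eq [comp_intros]:
  assumes "computable_fun n f" "computable_fun n g"
  shows "decidable n (\<lambda>xs. f xs = g xs)"
  by (rule decidable_cong[of _ "\<lambda>xs. \<not> f xs < g xs \<and> \<not> g xs < f xs"])
    (use assms in \<open>auto intro!: comp_intros\<close>)

lemma decidable_finite:
  assumes "finite A" "computable_fun n f"
  shows "decidable n (\<lambda>xs. f xs \<in> A)"
  using assms(1) by induction (auto intro!: comp_intros assms(2))

text \<open>Bounded search is a primitive recursion up to the bound whose value is a flag recording
  whether a witness has been found.\<close>

lemma decidable_bex_less [comp_intros]:
  assumes "decidable (Suc n) (\<lambda>ys. Q (hd ys) (tl ys))" "computable_fun n b"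
  shows "decidable n (\<lambda>xs. \<exists>k<b xs. Q k xs)"
proof -
  \<comment> \<open>The step function of the recursion receives counter, flag and parameters,
    whereas \<open>Q\<close> expects no flag; composing with projections drops it.\<close>
  have shift: "computable_fun (Suc (Suc n)) (\<lambda>xs. if Q (hd xs) (tl (tl xs)) then 1 else 0)"
  proof -
    let ?gs = "(\<lambda>xs. xs ! 0) # map (\<lambda>i xs. xs ! Suc (Suc i)) [0..<n]"
    have "computable_fun (Suc (Suc n))
      (\<lambda>xs. (\<lambda>ys. if Q (hd ys) (tl ys) then 1 else 0) (map (\<lambda>g. g xs) ?gs))"
      by (rule computable_fun_Comp)
        (use assms(1) in \<open>auto simp: decidable_def intro!: comp_intros\<close>)
    then show ?thesis
    proof (rule computable_fun_cong)
      fix xs :: "nat list"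
      assume "length xs = Suc (Suc n)"
      then have "map (\<lambda>g. g xs) ?gs = hd xs # tl (tl xs)"
        by (auto simp: list_eq_iff_nth_eq nth_Cons nth_tl hd_conv_nth split: nat.splits)
      then show "(\<lambda>ys. if Q (hd ys) (tl ys) then 1 else 0) (map (\<lambda>g. g xs) ?gs) =
          (if Q (hd xs) (tl (tl xs)) then 1 else 0 :: nat)"
        by simp
    qed
  qed
  then have "decidable (Suc (Suc n)) (\<lambda>xs. 0 < xs ! 1 \<or> Q (hd xs) (tl (tl xs)))"
    unfolding decidable_def[symmetric] by (auto intro!: comp_intros)
  then have "computable_fun (Suc n) (\<lambda>xs. rec_nat ((\<lambda>_. 0) (tl xs)) (\<lambda>k r.
     (\<lambda>xs. if 0 < xs ! 1 \<or> Q (hd xs) (tl (tl xs)) then 1 else 0) (k # r # tl xs)) (hd xs))"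
    by (intro computable_fun_PrimRec comp_intros) (simp add: decidable_def)
  moreover have "rec_nat 0 (\<lambda>k r. if 0 < r \<or> Q k xs then 1 else 0) m =
      (if \<exists>k<m. Q k xs then 1 else 0 :: nat)" for m xs
    by (induction m) (auto simp: less_Suc_eq)
  ultimately have *: "computable_fun (Suc n) (\<lambda>xs. if \<exists>k<hd xs. Q k (tl xs) then 1 else 0)"
    by simp
  \<comment> \<open>The search is decidable with the bound as an extra first argument; now
    \<open>b\<close> is substituted for it and the parameters are passed on by projections.\<close>
  let ?gs = "b # map (\<lambda>i xs. xs ! i) [0..<n]"
  have "computable_fun n
      (\<lambda>xs. (\<lambda>ys. if \<exists>k<hd ys. Q k (tl ys) then 1 else 0) (map (\<lambda>g. g xs) ?gs))"
    by (rule computable_fun_Comp) (use * assms(2) in \<open>auto intro!: comp_intros\<close>)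
  then show ?thesis
    unfolding decidable_def
  proof (rule computable_fun_cong)
    fix xs :: "nat list"
    assume "length xs = n"
    then have "map (\<lambda>g. g xs) ?gs = b xs # xs"
      by (auto simp: list_eq_iff_nth_eq nth_Cons split: nat.splits)
    then show "(\<lambda>ys. if \<exists>k<hd ys. Q k (tl ys) then 1 else 0) (map (\<lambda>g. g xs) ?gs) =
        (if \<exists>k<b xs. Q k xs then 1 else 0 :: nat)"
      by simp
  qed
qed

lemma decidable_ball_less [comp_intros]:
  assumes "decidable (Suc n) (\<lambda>ys. Q (hd ys) (tl ys))" "computable_fun n b"
  shows "decidable n (\<lambda>xs. \<forall>k<b xs. Q k xs)"
  using decidable_not[OF decidable_bex_less[of n "\<lambda>k xs. \<not> Q k xs", OF decidable_not assms(2)]]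
    assms(1) by simp

section \<open>Computable sets and relations as decidable predicates\<close>

lemma computable_set_iff: "computable_set A \<longleftrightarrow> decidable 1 (\<lambda>xs. xs ! 0 \<in> A)"
proof -
  have "(\<forall>xs. length xs = 1 \<longrightarrow> P xs) \<longleftrightarrow> (\<forall>x. P [x])" for P :: "nat list \<Rightarrow> bool"
    by (auto simp: length_Suc_conv)
  then show ?thesis by (simp add: computable_set_def decidable_def computable_fun_def)
qed

lemma computable_rel_iff: "computable_rel R \<longleftrightarrow> decidable 2 (\<lambda>xs. (xs ! 0, xs ! 1) \<in> R)"
proof -
  have "(\<forall>xs. length xs = 2 \<longrightarrow> P xs) \<longleftrightarrow> (\<forall>x y. P [x, y])" for P :: "nat list \<Rightarrow> bool"
    by (auto simp: length_Suc_conv numeral_2_eq_2)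
  then show ?thesis by (simp add: computable_rel_def decidable_def computable_fun_def)
qed

lemma decidable_computable_set [comp_intros]:
  assumes "computable_set A" "computable_fun n f"
  shows "decidable n (\<lambda>xs. f xs \<in> A)"
  using assms(1) computable_fun_comp1[of "\<lambda>x. if x \<in> A then 1 else 0", OF _ assms(2)]
  by (simp add: decidable_def computable_set_iff)

lemma computable_set_finite: "finite A \<Longrightarrow> computable_set A"
  unfolding computable_set_iff by (intro decidable_finite computable_fun_nth) auto

lemma decidable_computable_rel [comp_intros]:
  assumes "computable_rel R" "computable_fun n f" "computable_fun n g"
  shows "decidable n (\<lambda>xs. (f xs, g xs) \<in> R)"
  using assms(1) computable_fun_comp2[of "\<lambda>x y. if (x, y) \<in> R then 1 else 0", OF _ assms(2,3)]
  by (simp add: decidable_def computable_rel_iff)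

section \<open>Isomorphisms, complements and splittings\<close>

lemma graph_iso_refl: "graph_iso G G"
  unfolding graph_iso_def by (intro exI[of _ id]) auto

lemma graph_iso_sym:
  assumes "graph_iso G H"
  shows "graph_iso H G"
proof -
  obtain f where f: "bij_betw f (verts G) (verts H)"
    and e: "\<forall>x\<in>verts G. \<forall>y\<in>verts G. (x, y) \<in> edges G \<longleftrightarrow> (f x, f y) \<in> edges H"
    using assms by (auto simp: graph_iso_def)
  let ?g = "the_inv_into (verts G) f"
  have g: "bij_betw ?g (verts H) (verts G)"
    by (rule bij_betw_the_inv_into[OF f])
  moreover have "f (?g y) = y" if "y \<in> verts H" for y
    using f that by (simp add: f_the_inv_into_f_bij_betw)
  moreover have "?g y \<in> verts G" if "y \<in> verts H" for y
    using g that by (auto simp: bij_betw_def)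
  ultimately show ?thesis
    unfolding graph_iso_def using e by (intro exI[of _ ?g]) auto
qed

section \<open>Complementation and its effect on splittings\<close>

definition complement :: "graph \<Rightarrow> graph" where
  "complement G = \<lparr>verts = verts G, edges = {(x, y) \<in> verts G \<times> verts G. x \<noteq> y \<and> (x, y) \<notin> edges G}\<rparr>"

text \<open>Applied to \<open>complement G\<close>, this describes the dominating vertices of
  \<open>G\<close>.\<close>

definition isolated :: "graph \<Rightarrow> nat \<Rightarrow> bool" where
  "isolated G x \<longleftrightarrow> x \<in> verts G \<and> (\<forall>y. (x, y) \<notin> edges G)"

text \<open>This is the conclusion of the theorem, named so that it can be transferred between a
  graph and its complement. A copy \<open>H\<close> other than \<open>G\<close> is built only for
  isolated or dominating vertices.\<close>

definition splittable :: "graph \<Rightarrow> bool" where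
  "splittable G \<longleftrightarrow> (\<exists>H X0 X1. computable_graph H \<and> graph_iso H G \<and>
           computable_set X0 \<and> computable_set X1 \<and>
           X0 \<union> X1 = verts H \<and> X0 \<inter> X1 = {} \<and>
           \<not> graph_iso (induced_subgraph H X0) G \<and>
           \<not> graph_iso (induced_subgraph H X1) G)"

lemma verts_complement [simp]: "verts (complement G) = verts G"
  by (simp add: complement_def)

lemma verts_induced_subgraph [simp]: "verts (induced_subgraph G X) = verts G \<inter> X"
  by (simp add: induced_subgraph_def)

lemma edges_induced_subgraph [simp]: "edges (induced_subgraph G X) = edges G \<inter> X \<times> X"
  by (simp add: induced_subgraph_def)

lemma is_graph_induced_subgraph: "is_graph G \<Longrightarrow> is_graph (induced_subgraph G X)"
  by (auto simp: is_graph_def irrefl_def sym_def)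

text \<open>Loops and edges leaving the vertex set would be lost in the double complement, hence the
  assumption \<open>is_graph G\<close>.\<close>

lemma complement_complement:
  "is_graph G \<Longrightarrow> complement (complement G) = G"
  by (cases G) (auto simp: complement_def is_graph_def irrefl_def)

lemma complement_induced_subgraph:
  "complement (induced_subgraph G X) = induced_subgraph (complement G) X"
  by (auto simp: complement_def induced_subgraph_def)

lemma graph_iso_complement:
  assumes "graph_iso G H"
  shows "graph_iso (complement G) (complement H)"
proof -
  obtain f where f: "bij_betw f (verts G) (verts H)"
    and e: "\<forall>x\<in>verts G. \<forall>y\<in>verts G. (x, y) \<in> edges G \<longleftrightarrow> (f x, f y) \<in> edges H"
    using assms by (auto simp: graph_iso_def)
  have "f x \<in> verts H" if "x \<in> verts G" for x
    using f that by (auto simp: bij_betw_def)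
  moreover have "f x = f y \<longleftrightarrow> x = y" if "x \<in> verts G" "y \<in> verts G" for x y
    using f that by (auto simp: bij_betw_def inj_on_def)
  ultimately show ?thesis
    unfolding graph_iso_def using f e by (intro exI[of _ f]) (auto simp: complement_def)
qed

lemma graph_iso_complement_iff:
  assumes "is_graph G" "is_graph H"
  shows "graph_iso (complement G) (complement H) \<longleftrightarrow> graph_iso G H"
  using graph_iso_complement[of G H] graph_iso_complement[of "complement G" "complement H"]
  by (auto simp: assms complement_complement)

lemma is_graph_complement: "is_graph G \<Longrightarrow> is_graph (complement G)"
  by (auto simp: is_graph_def complement_def irrefl_def sym_def)

lemma computable_graph_complement:
  assumes "computable_graph G"
  shows "computable_graph (complement G)"
proof -
  have "decidable 2 (\<lambda>xs. xs ! 0 \<in> verts G \<and> xs ! 1 \<in> verts G \<and>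
      \<not> xs ! 0 = xs ! 1 \<and> \<not> (xs ! 0, xs ! 1) \<in> edges G)"
    using assms unfolding computable_graph_def by (auto intro!: comp_intros)
  with assms show ?thesis
    unfolding computable_graph_def
    by (simp add: is_graph_complement computable_rel_iff) (simp add: complement_def)
qed

text \<open>The same partition serves for the complement of \<open>H\<close>, because
  complementation commutes with induced subgraphs and both preserves and reflects
  isomorphism.\<close>

lemma splittable_complement:
  assumes "splittable (complement G)" "is_graph G"
  shows "splittable G"
proof -
  obtain H X0 X1 where H: "computable_graph H" "graph_iso H (complement G)"
    "computable_set X0" "computable_set X1" "X0 \<union> X1 = verts H" "X0 \<inter> X1 = {}"
    "\<not> graph_iso (induced_subgraph H X0) (complement G)"
    "\<not> graph_iso (induced_subgraph H X1) (complement G)"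
    using assms(1) unfolding splittable_def by blast
  have gH: "is_graph H" using H(1) by (simp add: computable_graph_def)
  have "graph_iso (complement K) G \<longleftrightarrow> graph_iso K (complement G)" if "is_graph K" for K
    using graph_iso_complement_iff[OF that is_graph_complement[OF assms(2)]]
    by (simp add: complement_complement assms(2))
  with H gH show ?thesis
    unfolding splittable_def
    by (intro exI[of _ "complement H"] exI[of _ X0] exI[of _ X1])
      (simp add: computable_graph_complement is_graph_induced_subgraph
        flip: complement_induced_subgraph)
qed

section \<open>Isomorphism invariants and the finite case\<close>

lemma graph_iso_isolated:
  assumes "graph_iso G H" "is_graph H" "isolated G x"
  shows "\<exists>y. isolated H y"
proof -
  obtain f where f: "bij_betw f (verts G) (verts H)"
    and e: "\<forall>x\<in>verts G. \<forall>y\<in>verts G. (x, y) \<in> edges G \<longleftrightarrow> (f x, f y) \<in> edges H"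
    using assms by (auto simp: graph_iso_def)
  have "(f x, z) \<notin> edges H" for z
  proof
    assume z: "(f x, z) \<in> edges H"
    then have "z \<in> f ` verts G" using assms(2) f by (auto simp: is_graph_def bij_betw_def)
    then show False using z e assms(3) by (auto simp: isolated_def)
  qed
  with f assms(3) show ?thesis
    by (auto simp: isolated_def bij_betw_def)
qed

lemma graph_iso_edgeless:
  assumes "graph_iso G H" "is_graph H" "edges G = {}"
  shows "edges H = {}"
proof -
  have "isolated H y" if "y \<in> verts H" for y
  proof -
    obtain f where f: "bij_betw f (verts H) (verts G)"
      and e: "\<forall>x\<in>verts H. \<forall>y\<in>verts H. (x, y) \<in> edges H \<longleftrightarrow> (f x, f y) \<in> edges G"
      using graph_iso_sym[OF assms(1)] by (auto simp: graph_iso_def)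
    then show ?thesis
      using that assms(2,3) by (auto simp: isolated_def is_graph_def)
  qed
  with assms(2) show ?thesis by (auto simp: isolated_def is_graph_def)
qed

text \<open>Cardinality separates both parts from \<open>G\<close>. Two vertices are essential: with
  at most one, some part is always the whole graph.\<close>

lemma splittable_finite:
  assumes "computable_graph G" "finite (verts G)" "x \<in> verts G" "y \<in> verts G" "x \<noteq> y"
  shows "splittable G"
proof -
  have card: "card (verts K) = card (verts G)" if "graph_iso K G" for K
    using that by (auto simp: graph_iso_def dest: bij_betw_same_card)
  have "card {x, y} \<le> card (verts G)"
    using assms by (intro card_mono) auto
  then have less: "card {x} < card (verts G)" "card (verts G - {x}) < card (verts G)"
    using assms(2,3,5) by (simp_all add: card_Diff1_less)
  have verts: "verts (induced_subgraph G {x}) = {x}"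
      "verts (induced_subgraph G (verts G - {x})) = verts G - {x}"
    using assms(3) by auto
  have "\<not> graph_iso (induced_subgraph G {x}) G"
      "\<not> graph_iso (induced_subgraph G (verts G - {x})) G"
    using less verts card by (metis less_irrefl)+
  moreover have "{x} \<union> (verts G - {x}) = verts G" using assms by auto
  moreover have "computable_set {x}" "computable_set (verts G - {x})"
    using assms by (auto intro!: computable_set_finite)
  ultimately show ?thesis
    unfolding splittable_def using assms(1) graph_iso_refl[of G] by blast
qed

section \<open>Graphs with isolated vertices\<close>

text \<open>The isolated vertices of \<open>G\<close> are only co-computably enumerable. In the new copy, a non-isolated
  vertex is represented by the (even) code of itself together with its least neighbour, which makes
  the set of its representatives computable; the isolated vertices are represented by odd numbers.\<close>

lemma splittable_isolated:
  assumes G: "computable_graph G" and iso: "isolated G u" and edge: "edges G \<noteq> {}"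
  shows "splittable G"
proof -
  define E where "E = edges G"
  have cE: "computable_rel E" and gG: "is_graph G"
    using G by (auto simp: computable_graph_def E_def)
  have EV: "x \<in> verts G" "y \<in> verts G" "(y, x) \<in> E" "x \<noteq> y" if "(x, y) \<in> E" for x y
    using gG that by (auto simp: is_graph_def E_def sym_def irrefl_def)
  \<comment> \<open>For isolated \<open>x\<close> the \<open>LEAST\<close> is unspecified, but such
    codes never enter \<open>H\<close>. Injectivity only needs the first component of the
    pair.\<close>
  define code where "code x = 2 * prod_encode (x, LEAST y. (x, y) \<in> E)" for x
  define I where "I = verts G - Domain E"
  \<comment> \<open>Only the number of isolated vertices matters. The bijection \<open>h\<close> may
    be noncomputable, since \<open>H\<close> and \<open>G\<close> need only be classically
    isomorphic.\<close>
  obtain O' h where O': "computable_set O'" and h: "bij_betw h I O'"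
  proof (cases "finite I")
    case True
    then obtain h where "bij_betw h I {0..<card I}" using ex_bij_betw_finite_nat by blast
    moreover have "computable_set {0..<card I}"
      by (intro computable_set_finite) simp
    ultimately show ?thesis using that by blast
  next
    case False
    then have "bij_betw (to_nat_on I) I UNIV" by (intro to_nat_on_infinite) auto
    moreover have "computable_set UNIV"
      by (auto simp: computable_set_iff intro!: comp_intros)
    ultimately show ?thesis using that by blast
  qed
  define X0 where "X0 = (\<lambda>k. Suc (2 * k)) ` O'"
  define X1 where "X1 = code ` Domain E"
  define H where "H = \<lparr>verts = X0 \<union> X1, edges = (\<lambda>(x, y). (code x, code y)) ` E\<rparr>"
  have code_inj: "code x = code y \<longleftrightarrow> x = y" for x y
    by (auto simp: code_def)
  have code_le: "x \<le> code x" for x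
    using le_prod_encode_1[of x "LEAST y. (x, y) \<in> E"] by (simp add: code_def)
  \<comment> \<open>\<open>R\<close> decodes a representative. It is computable although
    \<open>Domain E\<close> need not be: \<open>v\<close> bounds the least neighbour, so only
    finitely many pairs are tested. Doubling is written as a sum to fit the closure rules.\<close>
  define R where "R = {(v, x). x \<in> Domain E \<and> v = code x}"
  have "(v, x) \<in> R \<longleftrightarrow> (\<exists>y<Suc v. v = prod_encode (x, y) + prod_encode (x, y) \<and> (x, y) \<in> E \<and>
      (\<forall>z<y. (x, z) \<notin> E))" (is "_ \<longleftrightarrow> ?rhs") for v x
  proof
    assume "(v, x) \<in> R"
    then obtain y where y: "(x, y) \<in> E" "v = code x" by (auto simp: R_def)
    let ?y = "LEAST y. (x, y) \<in> E"
    have "(x, ?y) \<in> E" using y(1) by (rule LeastI)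
    moreover have "?y < Suc v"
      using le_prod_encode_2[of ?y x] y(2) by (simp add: code_def)
    ultimately show ?rhs
      using y(2) by (intro exI[of _ ?y]) (auto simp: code_def dest: not_less_Least)
  next
    assume ?rhs
    then obtain y where y: "v = prod_encode (x, y) + prod_encode (x, y)" "(x, y) \<in> E"
      "(\<forall>z<y. (x, z) \<notin> E)" by blast
    then have "(LEAST y. (x, y) \<in> E) = y" by (intro Least_equality) (auto simp: not_less[symmetric])
    with y show "(v, x) \<in> R" by (auto simp: R_def code_def)
  qed
  then have cR: "computable_rel R"
    unfolding computable_rel_iff using cE by (auto intro!: comp_intros)
  have "v \<in> X1 \<longleftrightarrow> (\<exists>x<Suc v. (v, x) \<in> R)" for v
    using code_le by (auto simp: X1_def R_def less_Suc_eq_le)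
  then have cX1: "computable_set X1"
    unfolding computable_set_iff using cR by (auto intro!: comp_intros)
  have "v \<in> X0 \<longleftrightarrow> (\<exists>k<v. v = Suc (k + k) \<and> k \<in> O')" for v
    unfolding X0_def mult_2 image_iff by (metis less_Suc_eq_le le_add1)
  then have cX0: "computable_set X0"
    unfolding computable_set_iff using O' by (auto intro!: comp_intros)
  \<comment> \<open>A vertex is at most its code, so both endpoints are recovered by bounded search
    and compared in \<open>E\<close>.\<close>
  have edgesH: "(v, w) \<in> edges H \<longleftrightarrow> (\<exists>x<Suc v. \<exists>y<Suc w. (v, x) \<in> R \<and> (w, y) \<in> R \<and> (x, y) \<in> E)"
    for v w
  proof
    assume "(v, w) \<in> edges H"
    then obtain x y where "(x, y) \<in> E" "v = code x" "w = code y" by (auto simp: H_def)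
    then show "\<exists>x<Suc v. \<exists>y<Suc w. (v, x) \<in> R \<and> (w, y) \<in> R \<and> (x, y) \<in> E"
      using code_le EV unfolding R_def less_Suc_eq_le by blast
  qed (auto simp: H_def R_def)
  have "computable_rel (edges H)"
    unfolding computable_rel_iff edgesH using cR cE by (auto intro!: comp_intros)
  moreover have "decidable 1 (\<lambda>xs. xs ! 0 \<in> X0 \<or> xs ! 0 \<in> X1)"
    using cX0 cX1 by (auto intro!: comp_intros)
  then have "computable_set (verts H)"
    by (simp add: computable_set_iff H_def)
  moreover have gH: "is_graph H"
    unfolding is_graph_def
  proof (intro conjI)
    show "edges H \<subseteq> verts H \<times> verts H"
      using EV(3) unfolding H_def X1_def by fastforce
    show "irrefl (edges H)"
      using EV(4) by (auto simp: H_def irrefl_def code_inj)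
    show "sym (edges H)"
      using EV(3) unfolding H_def sym_def by fastforce
  qed
  ultimately have cH: "computable_graph H"
    by (simp add: computable_graph_def)
  define g where "g x = (if x \<in> Domain E then code x else Suc (2 * h x))" for x
  have "bij_betw g (Domain E \<union> I) (X1 \<union> X0)"
  proof (rule bij_betw_combine)
    have "bij_betw code (Domain E) X1"
      unfolding X1_def by (intro inj_on_imp_bij_betw) (auto simp: inj_on_def code_inj)
    then show "bij_betw g (Domain E) X1"
      by (rule bij_betw_cong[THEN iffD1, rotated]) (simp add: g_def)
    have "bij_betw (\<lambda>k. Suc (2 * k)) O' X0"
      unfolding X0_def by (intro inj_on_imp_bij_betw) (auto simp: inj_on_def)
    from bij_betw_trans[OF h this] show "bij_betw g I X0"
      by (rule bij_betw_cong[THEN iffD1, rotated]) (simp add: g_def I_def)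
    show "X1 \<inter> X0 = {}"
      by (auto simp: X0_def X1_def code_def) presburger
  qed
  moreover have "Domain E \<union> I = verts G" using EV by (auto simp: I_def)
  ultimately have "bij_betw g (verts G) (verts H)" by (simp add: H_def Un_commute)
  moreover have "(x, y) \<in> edges G \<longleftrightarrow> (g x, g y) \<in> edges H" for x y
  proof (cases "x \<in> Domain E \<and> y \<in> Domain E")
    case True
    then show ?thesis by (force simp: g_def H_def code_inj E_def)
  next
    case False
    then have "(x, y) \<notin> E" using EV by blast
    \<comment> \<open>By parity, representatives of isolated vertices are never endpoints of edges
      of \<open>H\<close>.\<close>
    moreover have "Suc (2 * k) \<noteq> code z" for k z by (simp add: code_def) presburger
    ultimately show ?thesis using False by (auto simp: g_def H_def E_def)
  qed
  ultimately have "graph_iso G H" by (auto simp: graph_iso_def)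
  then have "graph_iso H G" by (rule graph_iso_sym)
  moreover have disj: "X0 \<inter> X1 = {}"
    by (auto simp: X0_def X1_def code_def) presburger
  moreover have "\<not> graph_iso (induced_subgraph H X0) G"
  proof
    have "edges (induced_subgraph H X0) = {}"
      using disj EV by (auto simp: H_def X1_def)
    moreover assume "graph_iso (induced_subgraph H X0) G"
    ultimately show False using graph_iso_edgeless gG edge by blast
  qed
  moreover have "\<not> graph_iso (induced_subgraph H X1) G"
  proof
    assume "graph_iso (induced_subgraph H X1) G"
    then obtain v where "isolated (induced_subgraph H X1) v"
      using graph_iso_isolated[OF graph_iso_sym _ iso] is_graph_induced_subgraph[OF gH] by blast
    \<comment> \<open>By symmetry of \<open>E\<close>, the vertex \<open>y\<close> is also
      non-isolated, so \<open>code y\<close> lies in \<open>X1\<close> and remains a neighbour of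
      \<open>v\<close> there.\<close>
    then obtain x y where "v = code x" "(x, y) \<in> E"
      and none: "(v, code y) \<notin> edges H \<inter> X1 \<times> X1"
      by (auto simp: isolated_def X1_def)
    then have "(v, code y) \<in> edges H \<inter> X1 \<times> X1"
      using EV(3) by (auto simp: H_def X1_def)
    with none show False ..
  qed
  ultimately show ?thesis
    unfolding splittable_def using cH cX0 cX1
    by (intro exI[of _ H] exI[of _ X0] exI[of _ X1]) (simp add: H_def)
qed

section \<open>Failure of the extension property\<close>

definition witness :: "graph \<Rightarrow> nat set \<Rightarrow> nat set \<Rightarrow> nat \<Rightarrow> bool" where
  "witness G A B x \<longleftrightarrow> x \<in> verts G - (A \<union> B) \<and>
     (\<forall>a\<in>A. (x, a) \<in> edges G) \<and> (\<forall>b\<in>B. (x, b) \<notin> edges G)"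

text \<open>Grading the property of the random graph by the size of the configuration gives a least
  failing size and, at each size, an isomorphism invariant.\<close>

definition extension :: "graph \<Rightarrow> nat \<Rightarrow> bool" where
  "extension G k \<longleftrightarrow> (\<forall>A B. finite A \<and> finite B \<and> A \<subseteq> verts G \<and> B \<subseteq> verts G \<and> A \<inter> B = {} \<and>
     card (A \<union> B) = k \<longrightarrow> (\<exists>x. witness G A B x))"

lemma extensionD:
  assumes "extension G (card (A \<union> B))" "finite (A \<union> B)" "A \<union> B \<subseteq> verts G" "A \<inter> B = {}"
  shows "\<exists>x. witness G A B x"
  using assms(1)[unfolded extension_def, rule_format, of A B] assms(2-4) by simp

lemma is_random_graph_iff: "is_random_graph G \<longleftrightarrow> is_graph G \<and> (\<forall>k. extension G k)"
proof -
  have "(\<exists>x\<in>verts G - (A \<union> B). (\<forall>a\<in>A. (x, a) \<in> edges G) \<and> (\<forall>b\<in>B. (x, b) \<notin> edges G)) \<longleftrightarrow>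
      (\<exists>x. witness G A B x)" for A B
    by (auto simp: witness_def)
  then show ?thesis unfolding is_random_graph_def extension_def by auto
qed

text \<open>The configuration is pushed forward along the isomorphism and the witness pulled back.
  In use, a part failing at a size where \<open>G\<close> succeeds cannot be a copy of
  \<open>G\<close>.\<close>

lemma graph_iso_extension:
  assumes "graph_iso G H" "extension H k"
  shows "extension G k"
  unfolding extension_def
proof (intro allI impI, elim conjE)
  fix A B assume AB: "finite A" "finite B" "A \<subseteq> verts G" "B \<subseteq> verts G" "A \<inter> B = {}"
    "card (A \<union> B) = k"
  obtain f where f: "bij_betw f (verts G) (verts H)"
    and e: "\<forall>x\<in>verts G. \<forall>y\<in>verts G. (x, y) \<in> edges G \<longleftrightarrow> (f x, f y) \<in> edges H"
    using assms by (auto simp: graph_iso_def)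
  have inj: "inj_on f (verts G)" and im: "f ` verts G = verts H"
    using f by (auto simp: bij_betw_def)
  have "f ` A \<inter> f ` B = {}"
    using inj_on_image_Int[OF inj, of A B] AB by simp
  moreover have "card (f ` A \<union> f ` B) = k"
    using AB inj_on_subset[OF inj, of "A \<union> B"] by (simp add: card_image flip: image_Un)
  ultimately obtain y where y: "witness H (f ` A) (f ` B) y"
    using assms(2) AB im unfolding extension_def by (metis finite_imageI image_mono)
  then obtain x where "x \<in> verts G" "y = f x" unfolding witness_def im[symmetric] by blast
  with y AB e have "witness G A B x" by (auto simp: witness_def subset_iff)
  then show "\<exists>x. witness G A B x" ..
qed

text \<open>A minimal failing configuration splits into two smaller ones. Every vertex
  fails one of these two, and is put on the side where it does.\<close>

lemma splittable_not_extension: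
  assumes G: "computable_graph G" and m: "\<not> extension G m" "1 < m"
    and less: "\<And>k. k < m \<Longrightarrow> extension G k"
  shows "splittable G"
proof -
  obtain A B where AB: "finite A" "finite B" "A \<subseteq> verts G" "B \<subseteq> verts G" "A \<inter> B = {}"
    "card (A \<union> B) = m" and no: "\<And>x. \<not> witness G A B x"
    using m(1) by (auto simp: extension_def)
  have "A \<union> B \<noteq> {}" using AB(6) m(2) by auto
  then obtain a where a: "a \<in> A \<union> B" by blast
  \<comment> \<open>\<open>X0\<close> consists of \<open>a\<close> and the vertices outside
    \<open>A\<close> and \<open>B\<close> whose adjacency to \<open>a\<close> is wrong for a
    witness. The rest of \<open>A\<close> and \<open>B\<close> falls into \<open>X1\<close>.
    Finitely many parameters suffice to decide this.\<close>
  define X0 where "X0 = {x \<in> verts G. x = a \<or>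
    (x \<notin> A \<union> B \<and> (((x, a) \<in> edges G \<and> a \<notin> A) \<or> (\<not> (x, a) \<in> edges G \<and> a \<in> A)))}"
  define X1 where "X1 = verts G - X0"
  have comp: "computable_set (verts G)" "computable_rel (edges G)"
    using G by (auto simp: computable_graph_def)
  have cX0: "computable_set X0"
    unfolding X0_def computable_set_iff mem_Collect_eq Un_iff
    using AB(1,2)[THEN computable_set_finite] comp
    by (auto intro!: comp_intros)
  have "decidable 1 (\<lambda>xs. xs ! 0 \<in> verts G \<and> \<not> xs ! 0 \<in> X0)"
    using comp cX0 by (auto intro!: comp_intros)
  then have cX1: "computable_set X1" by (simp add: X1_def computable_set_iff)
  have "\<not> extension (induced_subgraph G X0) 1"
  proof
    assume ext: "extension (induced_subgraph G X0) 1"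
    \<comment> \<open>Intersecting with \<open>{a}\<close> treats the cases of \<open>a\<close> in
      \<open>A\<close> and \<open>a\<close> in \<open>B\<close> uniformly.\<close>
    have eq: "(A \<inter> {a}) \<union> (B \<inter> {a}) = {a}" using a by auto
    have "a \<in> X0" using a AB by (auto simp: X0_def)
    moreover have "(A \<inter> {a}) \<inter> (B \<inter> {a}) = {}" using AB(5) by auto
    moreover have "a \<in> verts G" using a AB(3,4) by auto
    ultimately have "\<exists>x. witness (induced_subgraph G X0) (A \<inter> {a}) (B \<inter> {a}) x"
      using ext by (intro extensionD) (simp_all only: eq, simp_all)
    then obtain x where "witness (induced_subgraph G X0) (A \<inter> {a}) (B \<inter> {a}) x" ..
    then have x: "x \<in> X0" "x \<noteq> a" and A: "a \<in> A \<Longrightarrow> (x, a) \<in> edges G"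
      and B: "a \<in> B \<Longrightarrow> (x, a) \<notin> edges G"
      using a \<open>a \<in> X0\<close> by (auto simp: witness_def)
    have "((x, a) \<in> edges G \<and> a \<notin> A) \<or> ((x, a) \<notin> edges G \<and> a \<in> A)"
      using x unfolding X0_def by blast
    then show False using A B a by blast
  qed
  then have "\<not> graph_iso (induced_subgraph G X0) G"
    using graph_iso_extension[OF _ less[OF m(2)]] by blast
  moreover have "\<not> extension (induced_subgraph G X1) (m - 1)"
  proof
    assume ext: "extension (induced_subgraph G X1) (m - 1)"
    have eq: "(A - {a}) \<union> (B - {a}) = (A \<union> B) - {a}" by auto
    have "card (A \<union> B - {a}) = m - 1"
      using a AB(6) by (simp add: card_Diff_singleton)
    moreover have "A \<union> B - {a} \<subseteq> verts G \<inter> X1" using AB(3,4) by (auto simp: X0_def X1_def)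
    moreover have "(A - {a}) \<inter> (B - {a}) = {}" using AB(5) by auto
    ultimately have "\<exists>x. witness (induced_subgraph G X1) (A - {a}) (B - {a}) x"
      using ext AB(1,2) by (intro extensionD) (simp_all only: eq, simp_all)
    then obtain x where "witness (induced_subgraph G X1) (A - {a}) (B - {a}) x" ..
    \<comment> \<open>Lying in \<open>X1\<close>, the vertex \<open>x\<close> differs from
      \<open>a\<close> and has the right adjacency to it, so it also witnesses the full
      configuration in \<open>G\<close>.\<close>
    then have "witness G A B x" using a AB(3-5) by (auto simp: witness_def X1_def X0_def)
    then show False using no by blast
  qed
  then have "\<not> graph_iso (induced_subgraph G X1) G"
    using graph_iso_extension[OF _ less[of "m - 1"]] m(2) by auto
  moreover have "X0 \<union> X1 = verts G" "X0 \<inter> X1 = {}" by (auto simp: X1_def X0_def)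
  ultimately show ?thesis
    unfolding splittable_def using G cX0 cX1 graph_iso_refl by blast
qed

text \<open>Size 0 needs only some vertex. At size 1, the absence of isolated vertices provides a
  neighbour and that of dominating vertices a non-neighbour. Hence a least failing size exceeds 1,
  so both pieces of the configuration are smaller.\<close>

lemma extension_le_1:
  assumes "is_graph G" "x \<in> verts G" "\<And>y. \<not> isolated G y" "\<And>y. \<not> isolated (complement G) y"
    and "k \<le> 1"
  shows "extension G k"
  unfolding extension_def
proof (intro allI impI, elim conjE)
  fix A B assume AB: "finite A" "finite B" "A \<subseteq> verts G" "B \<subseteq> verts G" "A \<inter> B = {}"
    "card (A \<union> B) = k"
  then consider "A = {}" "B = {}" | y where "A \<union> B = {y}"
    using assms(5) by (cases k) (auto simp: card_Suc_eq)
  then show "\<exists>x. witness G A B x"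
  proof cases
    case 1
    then show ?thesis using assms(2) by (auto simp: witness_def)
  next
    case (2 y)
    then have y: "y \<in> verts G" using AB by auto
    from 2 AB(5) consider "A = {y}" "B = {}" | "A = {}" "B = {y}"
      by (metis Int_absorb Un_singleton_iff)
    then show ?thesis
    proof cases
      case 1
      obtain z where "(y, z) \<in> edges G" using assms(3) y by (auto simp: isolated_def)
      with 1 assms(1) have "witness G A B z"
        by (auto simp: witness_def is_graph_def irrefl_def sym_def)
      then show ?thesis ..
    next
      case 2
      obtain z where "(y, z) \<in> edges (complement G)"
        using assms(4) y by (auto simp: isolated_def)
      with 2 assms(1) have "witness G A B z"
        by (auto simp: witness_def is_graph_def sym_def complement_def)
      then show ?thesis ..
    qed
  qed
qed

section \<open>Assembling the cases\<close>

theorem theorem3p2: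
  fixes G :: graph
  assumes "computable_graph G"
    and "\<exists>x\<in>verts G. \<exists>y\<in>verts G. x \<noteq> y"
    and "\<not> graph_iso G K_omega"
    and "\<not> graph_iso G edgeless_omega"
    and "\<And>R. is_random_graph R \<Longrightarrow> \<not> graph_iso G R"
  shows "\<exists>H X0 X1. computable_graph H \<and> graph_iso H G \<and>
           computable_set X0 \<and> computable_set X1 \<and>
           X0 \<union> X1 = verts H \<and> X0 \<inter> X1 = {} \<and>
           \<not> graph_iso (induced_subgraph H X0) G \<and>
           \<not> graph_iso (induced_subgraph H X1) G"
proof -
  have gG: "is_graph G" using assms(1) by (simp add: computable_graph_def)
  obtain x where x: "x \<in> verts G" using assms(2) by blast
  \<comment> \<open>Without edges, any enumeration of the vertices is an isomorphism.\<close>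
  have edgeless: "graph_iso K edgeless_omega" if "infinite (verts K)" "edges K = {}" for K
    unfolding graph_iso_def edgeless_omega_def
    using that to_nat_on_infinite[of "verts K"] by auto
  have K: "K_omega = complement edgeless_omega"
    by (auto simp: K_omega_def edgeless_omega_def complement_def)
  have edgeless_graph: "is_graph edgeless_omega"
    by (auto simp: is_graph_def edgeless_omega_def irrefl_def sym_def)
  consider (finite) "finite (verts G)"
    | (iso) y where "infinite (verts G)" "isolated G y"
    | (dom) y where "infinite (verts G)" "isolated (complement G) y"
    | (ext) "\<And>y. \<not> isolated G y" "\<And>y. \<not> isolated (complement G) y"
    by blast
  then have "splittable G"
  proof cases
    case finite
    then show ?thesis using assms(1,2) splittable_finite by blast
  next
    case iso
    then show ?thesis using edgeless assms(1,4) splittable_isolated by blast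
  next
    case dom
    \<comment> \<open>Otherwise the complement would be a copy of \<open>edgeless_omega\<close>,
      making \<open>G\<close> a copy of \<open>K_omega\<close>.\<close>
    have "edges (complement G) \<noteq> {}"
      using edgeless[of "complement G"] dom(1) assms(3) gG edgeless_graph
        graph_iso_complement[of "complement G" edgeless_omega]
      by (auto simp: K complement_complement)
    with dom(2) show ?thesis
      using splittable_isolated computable_graph_complement assms(1) splittable_complement gG
      by blast
  next
    case ext
    \<comment> \<open>The hypothesis on random graphs is applied to \<open>G\<close> itself, with
      the identity as isomorphism.\<close>
    have "\<not> is_random_graph G" using assms(5) graph_iso_refl by blast
    then have ex: "\<exists>k. \<not> extension G k" using gG by (simp add: is_random_graph_iff)
    define m where "m = (LEAST k. \<not> extension G k)"
    have m: "\<not> extension G m" unfolding m_def using ex by (rule LeastI_ex)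
    have less: "extension G k" if "k < m" for k
      using not_less_Least[of k "\<lambda>k. \<not> extension G k"] that unfolding m_def by blast
    have "1 < m" using extension_le_1[OF gG x ext] m by (meson not_less)
    then show ?thesis using splittable_not_extension assms(1) m less by blast
  qed
  then show ?thesis unfolding splittable_def .
qed

end
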